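(* Let $X$ be a compact metric space, $G_1=\{\mathrm{id}_X,f_1,\dots,f_m\}$ a finite set of continuous self-maps of $X$, $\Phi=(\phi_1,\dots,\phi_m)\in\mathcal C(X,\mathbb R^m)$ a continuous multi-potential, $Y\subset X$ and $\omega\in\Sigma_m^+$. Then $$P^+_l(\Phi,Y,G_1)\le P^A(\Phi,Y,G_1)\le P(\Phi,Y,G_1,\omega).$$ In particular, for any $1\le j\le m$, $$P^+_l(\Phi,Y,G_1)\le P^A(\Phi,Y,G_1)\le P(\phi_j,Y,f_j).$$
   Context: Let $(X,d)$ be a compact metric space, $f_1,\dots,f_m:X\to X$ continuous, $f_{j_1\dots j_n}:=f_{j_1}\circ\dots\circ f_{j_n}$. Let $\Sigma_m^*$ be the set of finite words $C=(i_1,\dots,i_n)$, $n\ge1$, over $\{1,\dots,m\}$, $n(C)=n$ the length, and $\Sigma_m^+$ the space of sequences $\omega=(\omega_0,\omega_1,\dots)$ over $\{1,\dots,m\}$. For $C=(i_1,\dots,i_n)$, $$B_n(y,C,\varepsilon)=\{z\in X: d(y,z)<\varepsilon,\ d(f_{i_k\dots i_1}(y),f_{i_k\dots i_1}(z))<\varepsilon,\ 1\le k\le n\},$$ $S_n\Phi(y,C)=\phi_{i_1}(y)+\phi_{i_2}(f_{i_1}(y))+\dots+\phi_{i_n}(f_{i_{n-1}\dots i_1}(y))$; for $\omega\in\Sigma_m^+$ set $B_n(y,\omega,\varepsilon)=B_n(y,(\omega_0,\dots,\omega_{n-1}),\varepsilon)$ and $S_n\Phi(y,\omega)=S_n\Phi(y,(\omega_0,\dots,\omega_{n-1}))$.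 Amalgamated pressure $P^A(\Phi,Y,G_1)$: $$M(\lambda,\Phi,Y,N,\varepsilon)=\inf_\Gamma\sum_{(C,y)\in\Gamma}\exp(-\lambda n(C)+S_{n(C)}\Phi(y,C)),$$ the infimum over at most countable $\Gamma\subset\Sigma_m^*\times X$ with $Y\subset\bigcup_{(C,y)\in\Gamma}B_{n(C)}(y,C,\varepsilon)$ and $n(C)\ge N$ for all $(C,y)\in\Gamma$; $m(\lambda,\Phi,Y,\varepsilon)=\lim_{N\to\infty}M(\lambda,\Phi,Y,N,\varepsilon)$; $P^A(\Phi,Y,G_1,\varepsilon)=\inf\{\lambda:m(\lambda,\Phi,Y,\varepsilon)=0\}$; $P^A(\Phi,Y,G_1)=\lim_{\varepsilon\to0}P^A(\Phi,Y,G_1,\varepsilon)$. Trajectory pressure $P(\Phi,Y,G_1,\omega)$ along a fixed $\omega\in\Sigma_m^+$: defined by the same procedure from $$M_\omega(\lambda,\Phi,Y,N,\varepsilon)=\inf\sum_{y\in\Gamma}\exp(-\lambda n+S_n\Phi(y,\omega)),$$ the infimum over at most countable $\Gamma\subset Y$ with integers $n=n(y)\ge N$ such that $Y\subset\bigcup_{y\in\Gamma}B_n(y,\omega,\varepsilon)$. Lower exhaustive pressure $P^+_l(\Phi,Y,G_1)$: let $B_n^+(x,G_1,\varepsilon)=\bigcup_{|C|=n}B_n(x,C,\varepsilon)$ (union over all words $C$ of length $n$), $s_n\Phi(x)=\inf_{\omega\in\Sigma_m^+}S_n\Phi(x,\omega)$, and $$M_l^+(\Phi,Y,\lambda,N,\varepsilon)=\inf\sum_{x\in\mathcal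 F}\exp(s_n\Phi(x)-\lambda n),$$ the infimum over at most countable families of centers $x\in\mathcal F\subset X$ with integers $n=n(x)\ge N$ such that $Y\subset\bigcup_{x\in\mathcal F}B_n^+(x,G_1,\varepsilon)$; $m_l^+(\Phi,Y,\lambda,\varepsilon)=\lim_{N\to\infty}M_l^+$; $P_l^+(\Phi,Y,G_1,\varepsilon)=\inf\{\lambda:m_l^+(\Phi,Y,\lambda,\varepsilon)=0\}$; $P_l^+(\Phi,Y,G_1)=\lim_{\varepsilon\to0}P_l^+(\Phi,Y,G_1,\varepsilon)$. $P(\phi_j,Y,f_j)$ is the usual (Bowen/Pesin–Pitskel, Carathéodory-type) topological pressure of the single potential $\phi_j$ for the single map $f_j$ on the (not necessarily compact or invariant) set $Y$; it is the trajectory pressure along $\omega=(j,j,j,\dots)$. All pressures take values in the extended reals. *)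

theory Defs
  imports "HOL-Analysis.Analysis"
begin

text \<open>The space is a compact set \<open>X\<close>; the generators \<open>f j\<close> and the potentials \<open>\<phi> j\<close> are
  indexed by \<open>j \<in> {1..m}\<close> and only matter on \<open>X\<close>.\<close>

definition words :: "nat \<Rightarrow> nat list set" where
  "words m = {C \<in> lists {1..m}. C \<noteq> []}"

definition seqs :: "nat \<Rightarrow> (nat \<Rightarrow> nat) set" where
  "seqs m = {\<omega>. \<forall>i. \<omega> i \<in> {1..m}}"

definition prefix_word :: "(nat \<Rightarrow> nat) \<Rightarrow> nat \<Rightarrow> nat list" where
  "prefix_word \<omega> n = map \<omega> [0..<n]"

text \<open>\<open>word_map f [j\<^sub>1, \<dots>, j\<^sub>n] = f j\<^sub>1 \<circ> \<dots> \<circ> f j\<^sub>n\<close>. Along a word \<open>C = [i\<^sub>1, \<dots>, i\<^sub>n]\<close> the generators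
  are applied from the left, so \<open>f\<^sub>i\<^sub>k \<circ> \<dots> \<circ> f\<^sub>i\<^sub>1\<close> is \<open>word_map f (rev (take k C))\<close>.\<close>

definition word_map :: "(nat \<Rightarrow> 'a \<Rightarrow> 'a) \<Rightarrow> nat list \<Rightarrow> 'a \<Rightarrow> 'a" where
  "word_map f js = foldr (\<lambda>j g. f j \<circ> g) js id"

definition word_ball ::
  "'a::metric_space set \<Rightarrow> (nat \<Rightarrow> 'a \<Rightarrow> 'a) \<Rightarrow> 'a \<Rightarrow> nat list \<Rightarrow> real \<Rightarrow> 'a set" where
  "word_ball X f y C \<epsilon> = {z \<in> X. dist y z < \<epsilon> \<and>
     (\<forall>k\<in>{1..length C}. dist (word_map f (rev (take k C)) y) (word_map f (rev (take k C)) z) < \<epsilon>)}"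

definition word_sum ::
  "(nat \<Rightarrow> 'a \<Rightarrow> 'a) \<Rightarrow> (nat \<Rightarrow> 'a \<Rightarrow> real) \<Rightarrow> 'a \<Rightarrow> nat list \<Rightarrow> real" where
  "word_sum f \<phi> y C = (\<Sum>k<length C. \<phi> (C ! k) (word_map f (rev (take k C)) y))"

text \<open>The passage from a covering sum \<open>M \<lambda> N \<epsilon>\<close> to a pressure, common to all the pressures.
  For every covering sum below, \<open>M \<lambda> N \<epsilon>\<close> is increasing in \<open>N\<close> and decreasing in \<open>\<epsilon>\<close>, so both
  limits exist. The exponent \<open>\<lambda>\<close> is real and the infimum is taken in the extended reals, so it is
  \<open>\<infinity>\<close> over the empty set and \<open>- \<infinity>\<close> over all of \<open>\<real>\<close>.\<close>

definition critical_exponent :: "(real \<Rightarrow> nat \<Rightarrow> ennreal) \<Rightarrow> ereal" where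
  "critical_exponent M = Inf (ereal ` {l. lim (\<lambda>N. M l N) = 0})"

definition caratheodory_pressure :: "(real \<Rightarrow> nat \<Rightarrow> real \<Rightarrow> ennreal) \<Rightarrow> ereal" where
  "caratheodory_pressure M = Lim (at_right 0) (\<lambda>\<epsilon>. critical_exponent (\<lambda>l N. M l N \<epsilon>))"

definition amalgamated_M ::
  "nat \<Rightarrow> 'a::metric_space set \<Rightarrow> (nat \<Rightarrow> 'a \<Rightarrow> 'a) \<Rightarrow> (nat \<Rightarrow> 'a \<Rightarrow> real) \<Rightarrow> 'a set
    \<Rightarrow> real \<Rightarrow> nat \<Rightarrow> real \<Rightarrow> ennreal" where
  "amalgamated_M m X f \<phi> Y l N \<epsilon> =
    (INF \<Gamma> \<in> {\<Gamma>. countable \<Gamma> \<and> \<Gamma> \<subseteq> words m \<times> X \<and> Y \<subseteq> (\<Union>(C, y)\<in>\<Gamma>. word_ball X f y C \<epsilon>) \<and>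
                  (\<forall>(C, y)\<in>\<Gamma>. N \<le> length C)}.
       \<Sum>\<^sub>\<infinity>(C, y)\<in>\<Gamma>. ennreal (exp (- l * real (length C) + word_sum f \<phi> y C)))"

definition amalgamated_pressure ::
  "nat \<Rightarrow> 'a::metric_space set \<Rightarrow> (nat \<Rightarrow> 'a \<Rightarrow> 'a) \<Rightarrow> (nat \<Rightarrow> 'a \<Rightarrow> real) \<Rightarrow> 'a set \<Rightarrow> ereal" where
  "amalgamated_pressure m X f \<phi> Y = caratheodory_pressure (amalgamated_M m X f \<phi> Y)"

definition trajectory_M ::
  "'a::metric_space set \<Rightarrow> (nat \<Rightarrow> 'a \<Rightarrow> 'a) \<Rightarrow> (nat \<Rightarrow> 'a \<Rightarrow> real) \<Rightarrow> 'a set \<Rightarrow> (nat \<Rightarrow> nat)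
    \<Rightarrow> real \<Rightarrow> nat \<Rightarrow> real \<Rightarrow> ennreal" where
  "trajectory_M X f \<phi> Y \<omega> l N \<epsilon> =
    (INF (\<Gamma>, n) \<in> {(\<Gamma>, n). countable \<Gamma> \<and> \<Gamma> \<subseteq> Y \<and> (\<forall>y\<in>\<Gamma>. N \<le> n y) \<and>
                       Y \<subseteq> (\<Union>y\<in>\<Gamma>. word_ball X f y (prefix_word \<omega> (n y)) \<epsilon>)}.
       \<Sum>\<^sub>\<infinity>y\<in>\<Gamma>. ennreal (exp (- l * real (n y) + word_sum f \<phi> y (prefix_word \<omega> (n y)))))"

definition trajectory_pressure ::
  "'a::metric_space set \<Rightarrow> (nat \<Rightarrow> 'a \<Rightarrow> 'a) \<Rightarrow> (nat \<Rightarrow> 'a \<Rightarrow> real) \<Rightarrow> 'a set \<Rightarrow> (nat \<Rightarrow> nat)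
    \<Rightarrow> ereal" where
  "trajectory_pressure X f \<phi> Y \<omega> = caratheodory_pressure (trajectory_M X f \<phi> Y \<omega>)"

definition exhaustive_ball ::
  "nat \<Rightarrow> 'a::metric_space set \<Rightarrow> (nat \<Rightarrow> 'a \<Rightarrow> 'a) \<Rightarrow> nat \<Rightarrow> 'a \<Rightarrow> real \<Rightarrow> 'a set" where
  "exhaustive_ball m X f n x \<epsilon> = (\<Union>C\<in>{C \<in> lists {1..m}. length C = n}. word_ball X f x C \<epsilon>)"

text \<open>The infimum is over a finite set of values, since a word sum depends only on the first \<open>n\<close>
  letters.\<close>

definition lower_sum ::
  "nat \<Rightarrow> (nat \<Rightarrow> 'a \<Rightarrow> 'a) \<Rightarrow> (nat \<Rightarrow> 'a \<Rightarrow> real) \<Rightarrow> nat \<Rightarrow> 'a \<Rightarrow> real" where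
  "lower_sum m f \<phi> n x = (INF \<omega>\<in>seqs m. word_sum f \<phi> x (prefix_word \<omega> n))"

definition lower_exhaustive_M ::
  "nat \<Rightarrow> 'a::metric_space set \<Rightarrow> (nat \<Rightarrow> 'a \<Rightarrow> 'a) \<Rightarrow> (nat \<Rightarrow> 'a \<Rightarrow> real) \<Rightarrow> 'a set
    \<Rightarrow> real \<Rightarrow> nat \<Rightarrow> real \<Rightarrow> ennreal" where
  "lower_exhaustive_M m X f \<phi> Y l N \<epsilon> =
    (INF (F, n) \<in> {(F, n). countable F \<and> F \<subseteq> X \<and> (\<forall>x\<in>F. N \<le> n x) \<and>
                       Y \<subseteq> (\<Union>x\<in>F. exhaustive_ball m X f (n x) x \<epsilon>)}.
       \<Sum>\<^sub>\<infinity>x\<in>F. ennreal (exp (lower_sum m f \<phi> (n x) x - l * real (n x))))"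

definition lower_exhaustive_pressure ::
  "nat \<Rightarrow> 'a::metric_space set \<Rightarrow> (nat \<Rightarrow> 'a \<Rightarrow> 'a) \<Rightarrow> (nat \<Rightarrow> 'a \<Rightarrow> real) \<Rightarrow> 'a set \<Rightarrow> ereal" where
  "lower_exhaustive_pressure m X f \<phi> Y = caratheodory_pressure (lower_exhaustive_M m X f \<phi> Y)"

text \<open>Topological pressure of one potential \<open>\<psi>\<close> for one map \<open>g\<close> on an arbitrary subset \<open>Y\<close>. The
  Bowen balls control the iterates \<open>0, \<dots>, n\<close>, in agreement with the balls along words.\<close>

definition bowen_ball :: "'a::metric_space set \<Rightarrow> ('a \<Rightarrow> 'a) \<Rightarrow> nat \<Rightarrow> 'a \<Rightarrow> real \<Rightarrow> 'a set" where
  "bowen_ball X g n y \<epsilon> = {z \<in> X. \<forall>k\<le>n. dist ((g ^^ k) y) ((g ^^ k) z) < \<epsilon>}"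

definition topological_M ::
  "'a::metric_space set \<Rightarrow> ('a \<Rightarrow> 'a) \<Rightarrow> ('a \<Rightarrow> real) \<Rightarrow> 'a set \<Rightarrow> real \<Rightarrow> nat \<Rightarrow> real \<Rightarrow> ennreal" where
  "topological_M X g \<psi> Y l N \<epsilon> =
    (INF (\<Gamma>, n) \<in> {(\<Gamma>, n). countable \<Gamma> \<and> \<Gamma> \<subseteq> Y \<and> (\<forall>y\<in>\<Gamma>. N \<le> n y) \<and>
                       Y \<subseteq> (\<Union>y\<in>\<Gamma>. bowen_ball X g (n y) y \<epsilon>)}.
       \<Sum>\<^sub>\<infinity>y\<in>\<Gamma>. ennreal (exp (- l * real (n y) + (\<Sum>k<n y. \<psi> ((g ^^ k) y)))))"

definition topological_pressure ::
  "'a::metric_space set \<Rightarrow> ('a \<Rightarrow> 'a) \<Rightarrow> ('a \<Rightarrow> real) \<Rightarrow> 'a set \<Rightarrow> ereal" where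
  "topological_pressure X g \<psi> Y = caratheodory_pressure (topological_M X g \<psi> Y)"

lemma word_map_replicate: "word_map f (replicate k j) = f j ^^ k"
  by (induction k) (auto simp: word_map_def)

lemma prefix_word_const: "prefix_word (\<lambda>_. j) n = replicate n j"
  by (simp add: prefix_word_def map_replicate_const)

lemma word_ball_replicate: "word_ball X f y (replicate n j) \<epsilon> = bowen_ball X (f j) n y \<epsilon>"
proof -
  have split: "(\<forall>k\<le>n. P k) \<longleftrightarrow> P 0 \<and> (\<forall>k\<in>{1..n}. P k)" for P
    by (metis One_nat_def Suc_leI atLeastAtMost_iff le0 neq0_conv)
  show ?thesis
    unfolding word_ball_def bowen_ball_def split
    by (auto simp: word_map_replicate min_absorb2 min_absorb1)
qed

lemma word_sum_replicate: "word_sum f \<phi> y (replicate n j) = (\<Sum>k<n. \<phi> j ((f j ^^ k) y))"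
  by (auto simp: word_sum_def word_map_replicate min_absorb2 min_absorb1 intro!: sum.cong)

lemma trajectory_pressure_const:
  "trajectory_pressure X f \<phi> Y (\<lambda>_. j) = topological_pressure X (f j) (\<phi> j) Y"
proof -
  have "trajectory_M X f \<phi> Y (\<lambda>_. j) = topological_M X (f j) (\<phi> j) Y"
    by (intro ext)
      (simp add: trajectory_M_def topological_M_def prefix_word_const word_ball_replicate
        word_sum_replicate)
  then show ?thesis
    by (simp add: trajectory_pressure_def topological_pressure_def)
qed

end

theory Submission
  imports Defs
begin

text \<open>Both inequalities compare covers. A cover of \<open>Y\<close> along \<open>\<omega>\<close> is in particular a cover by balls
  along words. Conversely a cover by balls along words is a cover by exhaustive balls, except that
  the same centre may occur with several lengths, whereas the length is a function of the centre in
  an exhaustive cover. To separate the centres, assign to each point of \<open>Y\<close> one ball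
  containing it and recentre every assigned ball at a point to which it was assigned. This doubles
  the radius and, by uniform continuity of the potentials, raises \<open>\<lambda>\<close> by an arbitrarily small
  amount, so it does not affect the limit \<open>\<epsilon> \<rightarrow> 0\<close>.\<close>

section \<open>From covering sums to pressures: the limits as suprema\<close>

text \<open>\<open>lim\<close> and \<open>Lim\<close> are total, so they carry information only once
  convergence is known. The two monotonicities supply it: both limits become suprema.\<close>

definition covering_sum :: "(real \<Rightarrow> nat \<Rightarrow> real \<Rightarrow> ennreal) \<Rightarrow> bool" where
  "covering_sum M \<longleftrightarrow> (\<forall>l \<epsilon>. mono (\<lambda>N. M l N \<epsilon>)) \<and> (\<forall>l N. antimono (M l N))"

lemma lim_covering_sum_eq_0_iff:
  assumes "covering_sum M"
  shows "lim (\<lambda>N. M l N \<epsilon>) = 0 \<longleftrightarrow> (\<forall>N. M l N \<epsilon> = 0)"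
proof -
  have "(\<lambda>N. M l N \<epsilon>) \<longlonglongrightarrow> (SUP N. M l N \<epsilon>)"
    using assms by (intro LIMSEQ_SUP) (simp add: covering_sum_def)
  then have "lim (\<lambda>N. M l N \<epsilon>) = (SUP N. M l N \<epsilon>)"
    by (rule limI)
  then show ?thesis
    by (simp add: SUP_eq_iff flip: bot_ennreal)
qed

lemma critical_exponent_antimono:
  assumes M: "covering_sum M" and "\<epsilon> \<le> \<epsilon>'"
  shows "critical_exponent (\<lambda>l N. M l N \<epsilon>') \<le> critical_exponent (\<lambda>l N. M l N \<epsilon>)"
proof -
  have "M l N \<epsilon>' \<le> M l N \<epsilon>" for l N
    using assms by (auto simp: covering_sum_def antimono_def)
  then have "M l N \<epsilon>' = 0" if "M l N \<epsilon> = 0" for l N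
    using that by (metis le_zero_eq)
  then show ?thesis
    unfolding critical_exponent_def lim_covering_sum_eq_0_iff[OF M]
    by (intro Inf_superset_mono image_mono) auto
qed

text \<open>If some value at \<open>e\<close> exceeds \<open>c\<close>, antitonicity makes every
  value on the interval between \<open>a\<close> and \<open>e\<close> exceed
  \<open>c\<close>.\<close>

lemma tendsto_at_right_SUP_antimono:
  fixes h :: "real \<Rightarrow> ereal"
  assumes "\<And>x y. x \<le> y \<Longrightarrow> h y \<le> h x"
  shows "(h \<longlongrightarrow> (SUP x\<in>{a<..}. h x)) (at_right a)"
proof (rule order_tendstoI)
  fix c assume "c < (SUP x\<in>{a<..}. h x)"
  then obtain e where e: "a < e" "c < h e"
    by (auto simp: less_SUP_iff)
  have "eventually (\<lambda>x. x \<in> {a<..<e}) (at_right a)"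
    using e by (rule_tac eventually_at_right_real)
  then show "eventually (\<lambda>x. c < h x) (at_right a)"
    by eventually_elim (use e assms in \<open>auto intro: less_le_trans\<close>)
next
  fix c assume c: "(SUP x\<in>{a<..}. h x) < c"
  have "eventually (\<lambda>x. x \<in> {a<..}) (at_right a)"
    by (simp add: eventually_at_right_less)
  then show "eventually (\<lambda>x. h x < c) (at_right a)"
    by eventually_elim (use c in \<open>meson SUP_upper le_less_trans\<close>)
qed

lemma caratheodory_pressure_eq_SUP:
  assumes "covering_sum M"
  shows "caratheodory_pressure M = (SUP \<epsilon>\<in>{0<..}. critical_exponent (\<lambda>l N. M l N \<epsilon>))"
  unfolding caratheodory_pressure_def
  by (intro tendsto_Lim tendsto_at_right_SUP_antimono critical_exponent_antimono assms) auto

text \<open>The common criterion for both inequalities. Only vanishing for all \<open>N\<close> has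
  to be transferred, which leaves room to change the length bound. The radius may shrink, since the
  pressure is a supremum over radii, and the exponent may move by at most \<open>\<delta>\<close>,
  which is arbitrary.\<close>

lemma caratheodory_pressure_le:
  assumes M: "covering_sum M" and M': "covering_sum M'"
    and le: "\<And>\<delta> \<epsilon>'. \<delta> > 0 \<Longrightarrow> \<epsilon>' > 0 \<Longrightarrow>
      \<exists>\<epsilon>>0. \<exists>d\<le>\<delta>. \<forall>l. (\<forall>N. M l N \<epsilon> = 0) \<longrightarrow> (\<forall>N. M' (l + d) N \<epsilon>' = 0)"
  shows "caratheodory_pressure M' \<le> caratheodory_pressure M"
  unfolding caratheodory_pressure_eq_SUP[OF M']
proof (rule SUP_least)
  fix \<epsilon>' :: real assume \<epsilon>': "\<epsilon>' \<in> {0<..}"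
  show "critical_exponent (\<lambda>l N. M' l N \<epsilon>') \<le> caratheodory_pressure M"
  proof (rule ereal_le_epsilon2)
    fix \<delta> :: real assume "0 < \<delta>"
    then obtain \<epsilon> d where "\<epsilon> > 0" "d \<le> \<delta>"
      and shift: "\<And>l. \<forall>N. M l N \<epsilon> = 0 \<Longrightarrow> \<forall>N. M' (l + d) N \<epsilon>' = 0"
      using le[of \<delta> \<epsilon>'] \<epsilon>' by (metis greaterThan_iff)
    \<comment> \<open>Subtracting the finite \<open>\<delta>\<close> on the left leaves a bare
      infimum on the right, so each admissible exponent can be treated separately, infinite values
      included.\<close>
    have "critical_exponent (\<lambda>l N. M' l N \<epsilon>') - ereal \<delta> \<le> critical_exponent (\<lambda>l N. M l N \<epsilon>)"
      unfolding critical_exponent_def lim_covering_sum_eq_0_iff[OF M]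
        lim_covering_sum_eq_0_iff[OF M']
    proof (rule Inf_greatest, clarify)
      fix l assume "\<forall>N. M l N \<epsilon> = 0"
      then have "(INF l\<in>{l. \<forall>N. M' l N \<epsilon>' = 0}. ereal l) \<le> ereal (l + d)"
        using shift by (intro INF_lower) auto
      also have "\<dots> \<le> ereal (l + \<delta>)"
        using \<open>d \<le> \<delta>\<close> by simp
      finally show "(INF l\<in>{l. \<forall>N. M' l N \<epsilon>' = 0}. ereal l) - ereal \<delta> \<le> ereal l"
        by (simp add: ereal_minus_le)
    qed
    also have "\<dots> \<le> caratheodory_pressure M"
      unfolding caratheodory_pressure_eq_SUP[OF M] using \<open>\<epsilon> > 0\<close> by (intro SUP_upper) auto
    finally show "critical_exponent (\<lambda>l N. M' l N \<epsilon>') \<le> caratheodory_pressure M + ereal \<delta>"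
      by (simp add: ereal_minus_le)
  qed
qed

text \<open>Injectivity ensures that no term of the larger sum is charged twice; the terms outside
  the image are nonnegative.\<close>

lemma infsum_ennreal_reindex_le:
  fixes g :: "'a \<Rightarrow> ennreal"
  assumes "inj_on h A" "h ` A \<subseteq> B" "\<And>x. x \<in> A \<Longrightarrow> g x \<le> k (h x)"
  shows "infsum g A \<le> infsum k B"
proof -
  have "infsum g A \<le> infsum (k \<circ> h) A"
    using assms by (intro infsum_mono nonneg_summable_on_complete) auto
  also have "\<dots> = infsum k (h ` A)"
    using assms by (simp add: infsum_reindex)
  also have "\<dots> \<le> infsum k B"
    using assms by (intro infsum_mono_neutral nonneg_summable_on_complete) auto
  finally show ?thesis .
qed

section \<open>Monotonicity of the three covering sums\<close>

lemma word_ball_mono: "\<epsilon> \<le> \<epsilon>' \<Longrightarrow> word_ball X f y C \<epsilon> \<subseteq> word_ball X f y C \<epsilon>'"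
  by (force simp: word_ball_def)

text \<open>Raising the length bound or shrinking the radius leaves fewer admissible families, while
  the sum of each family is unchanged. The other two covering sums behave alike.\<close>

lemma covering_sum_amalgamated: "covering_sum (amalgamated_M m X f \<phi> Y)"
  unfolding covering_sum_def
proof (intro conjI allI monoI antimonoI)
  fix l \<epsilon> and N N' :: nat assume "N \<le> N'"
  then show "amalgamated_M m X f \<phi> Y l N \<epsilon> \<le> amalgamated_M m X f \<phi> Y l N' \<epsilon>"
    unfolding amalgamated_M_def by (intro INF_superset_mono order_refl) fastforce
next
  fix l N and \<epsilon> \<epsilon>' :: real assume "\<epsilon> \<le> \<epsilon>'"
  then have "(\<Union>(C, y)\<in>\<Gamma>. word_ball X f y C \<epsilon>) \<subseteq> (\<Union>(C, y)\<in>\<Gamma>. word_ball X f y C \<epsilon>')" for \<Gamma>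
    unfolding case_prod_beta by (intro UN_mono word_ball_mono order_refl)
  from subset_trans[OF _ this]
  show "amalgamated_M m X f \<phi> Y l N \<epsilon>' \<le> amalgamated_M m X f \<phi> Y l N \<epsilon>"
    unfolding amalgamated_M_def by (intro INF_superset_mono order_refl Collect_mono impI) metis
qed

lemma covering_sum_trajectory: "covering_sum (trajectory_M X f \<phi> Y \<omega>)"
  unfolding covering_sum_def
proof (intro conjI allI monoI antimonoI)
  fix l \<epsilon> and N N' :: nat assume "N \<le> N'"
  then show "trajectory_M X f \<phi> Y \<omega> l N \<epsilon> \<le> trajectory_M X f \<phi> Y \<omega> l N' \<epsilon>"
    unfolding trajectory_M_def case_prod_beta
    by (intro INF_superset_mono order_refl Collect_mono impI) (meson order_trans)
next
  fix l N and \<epsilon> \<epsilon>' :: real assume "\<epsilon> \<le> \<epsilon>'"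
  then have "(\<Union>y\<in>\<Gamma>. word_ball X f y (prefix_word \<omega> (n y)) \<epsilon>)
    \<subseteq> (\<Union>y\<in>\<Gamma>. word_ball X f y (prefix_word \<omega> (n y)) \<epsilon>')" for \<Gamma> n
    by (intro UN_mono word_ball_mono order_refl)
  from subset_trans[OF _ this]
  show "trajectory_M X f \<phi> Y \<omega> l N \<epsilon>' \<le> trajectory_M X f \<phi> Y \<omega> l N \<epsilon>"
    unfolding trajectory_M_def case_prod_beta
    by (intro INF_superset_mono order_refl Collect_mono impI) metis
qed

lemma covering_sum_lower_exhaustive: "covering_sum (lower_exhaustive_M m X f \<phi> Y)"
  unfolding covering_sum_def
proof (intro conjI allI monoI antimonoI)
  fix l \<epsilon> and N N' :: nat assume "N \<le> N'"
  then show "lower_exhaustive_M m X f \<phi> Y l N \<epsilon> \<le> lower_exhaustive_M m X f \<phi> Y l N' \<epsilon>"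
    unfolding lower_exhaustive_M_def case_prod_beta
    by (intro INF_superset_mono order_refl Collect_mono impI) (meson order_trans)
next
  fix l N and \<epsilon> \<epsilon>' :: real assume "\<epsilon> \<le> \<epsilon>'"
  then have "(\<Union>x\<in>F. exhaustive_ball m X f (n x) x \<epsilon>)
    \<subseteq> (\<Union>x\<in>F. exhaustive_ball m X f (n x) x \<epsilon>')" for F n
    unfolding exhaustive_ball_def by (intro UN_mono word_ball_mono order_refl)
  from subset_trans[OF _ this]
  show "lower_exhaustive_M m X f \<phi> Y l N \<epsilon>' \<le> lower_exhaustive_M m X f \<phi> Y l N \<epsilon>"
    unfolding lower_exhaustive_M_def case_prod_beta
    by (intro INF_superset_mono order_refl Collect_mono impI) metis
qed

section \<open>Amalgamated pressure against trajectory pressure\<close>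

text \<open>Each centre is paired with its prefix of \<open>\<omega>\<close>. Positivity of
  \<open>N\<close> rules out length 0, whose prefix is the empty word and does not belong to
  \<open>words m\<close>.\<close>

lemma amalgamated_M_le_trajectory_M:
  assumes "Y \<subseteq> X" "\<omega> \<in> seqs m" "N > 0"
  shows "amalgamated_M m X f \<phi> Y l N \<epsilon> \<le> trajectory_M X f \<phi> Y \<omega> l N \<epsilon>"
  unfolding trajectory_M_def
proof (rule INF_greatest, clarify)
  fix \<Gamma> n
  assume \<Gamma>: "countable \<Gamma>" "\<Gamma> \<subseteq> Y" "\<forall>y\<in>\<Gamma>. N \<le> n y"
    "Y \<subseteq> (\<Union>y\<in>\<Gamma>. word_ball X f y (prefix_word \<omega> (n y)) \<epsilon>)"
  let ?h = "\<lambda>y. (prefix_word \<omega> (n y), y)"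
  let ?t = "\<lambda>(C, y). ennreal (exp (- l * real (length C) + word_sum f \<phi> y C))"
  have len: "length (prefix_word \<omega> k) = k" for k
    by (simp add: prefix_word_def)
  have "?h ` \<Gamma> \<subseteq> words m \<times> X"
    using \<Gamma> assms by (fastforce simp: words_def seqs_def prefix_word_def)
  then have "amalgamated_M m X f \<phi> Y l N \<epsilon> \<le> infsum ?t (?h ` \<Gamma>)"
    unfolding amalgamated_M_def using \<Gamma> by (intro INF_lower) (auto simp: len)
  \<comment> \<open>The second component of \<open>?h y\<close> is \<open>y\<close> itself, so no
    two centres are merged.\<close>
  also have "\<dots> = infsum (?t \<circ> ?h) \<Gamma>"
    by (intro infsum_reindex) (auto simp: inj_on_def)
  also have "\<dots> = (\<Sum>\<^sub>\<infinity>y\<in>\<Gamma>. ennreal (exp (- l * real (n y) + word_sum f \<phi> y (prefix_word \<omega> (n y)))))"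
    by (intro infsum_cong) (simp add: len)
  finally show "amalgamated_M m X f \<phi> Y l N \<epsilon> \<le> \<dots>" .
qed

lemma amalgamated_le_trajectory_pressure:
  assumes "Y \<subseteq> X" "\<omega> \<in> seqs m"
  shows "amalgamated_pressure m X f \<phi> Y \<le> trajectory_pressure X f \<phi> Y \<omega>"
  unfolding amalgamated_pressure_def trajectory_pressure_def
proof (rule caratheodory_pressure_le[OF covering_sum_trajectory covering_sum_amalgamated])
  fix \<delta> \<epsilon>' :: real assume pos: "\<delta> > 0" "\<epsilon>' > 0"
  \<comment> \<open>Passing to \<open>Suc N\<close> covers the case \<open>N = 0\<close>; this costs
    nothing, as vanishing is assumed for every length bound.\<close>
  have "amalgamated_M m X f \<phi> Y l N \<epsilon>' \<le> trajectory_M X f \<phi> Y \<omega> l (Suc N) \<epsilon>'" for l N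
  proof -
    have "amalgamated_M m X f \<phi> Y l N \<epsilon>' \<le> amalgamated_M m X f \<phi> Y l (Suc N) \<epsilon>'"
      using covering_sum_amalgamated[of m X f \<phi> Y] by (auto simp: covering_sum_def mono_def)
    also have "\<dots> \<le> trajectory_M X f \<phi> Y \<omega> l (Suc N) \<epsilon>'"
      using assms by (intro amalgamated_M_le_trajectory_M) auto
    finally show ?thesis .
  qed
  \<comment> \<open>The criterion is used with \<open>d = 0\<close> and an unchanged radius.\<close>
  then have "\<forall>N. amalgamated_M m X f \<phi> Y (l + 0) N \<epsilon>' = 0"
    if "\<forall>N. trajectory_M X f \<phi> Y \<omega> l N \<epsilon>' = 0" for l
    using that by (metis add_0_right le_zero_eq)
  with pos show "\<exists>\<epsilon>>0. \<exists>d\<le>\<delta>. \<forall>l. (\<forall>N. trajectory_M X f \<phi> Y \<omega> l N \<epsilon> = 0) \<longrightarrow>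
      (\<forall>N. amalgamated_M m X f \<phi> Y (l + d) N \<epsilon>' = 0)"
    by (meson less_imp_le)
qed

section \<open>Moving the centre of a ball along a word\<close>

lemma word_map_in:
  assumes "\<And>j. j \<in> J \<Longrightarrow> f j \<in> X \<rightarrow> X" "set C \<subseteq> J" "x \<in> X"
  shows "word_map f C x \<in> X"
  using assms(2) by (induction C) (use assms in \<open>auto simp: word_map_def\<close>)

text \<open>Includes time 0, where the word map is the identity and the bound is the separate first
  condition of the ball.\<close>

lemma dist_word_map_less:
  assumes "z \<in> word_ball X f y C \<epsilon>" "k \<le> length C"
  shows "dist (word_map f (rev (take k C)) y) (word_map f (rev (take k C)) z) < \<epsilon>"
  using assms by (cases "k = 0") (auto simp: word_ball_def word_map_def)

text \<open>Triangle inequality through the orbit of \<open>y\<close>, at each time up to the length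
  of \<open>C\<close>.\<close>

lemma word_ball_recentre:
  assumes "z \<in> word_ball X f y C \<epsilon>"
  shows "word_ball X f y C \<epsilon> \<subseteq> word_ball X f z C (2 * \<epsilon>)"
proof
  fix w assume w: "w \<in> word_ball X f y C \<epsilon>"
  have *: "dist (word_map f (rev (take k C)) z) (word_map f (rev (take k C)) w) < 2 * \<epsilon>"
    if "k \<le> length C" for k
    using dist_word_map_less[OF assms that] dist_word_map_less[OF w that]
    by (metis dist_commute dist_triangle_less_add mult_2)
  show "w \<in> word_ball X f z C (2 * \<epsilon>)"
    using w *[of 0] * by (auto simp: word_ball_def word_map_def)
qed

text \<open>At every time the two orbits are within \<open>\<epsilon>\<close> of each other, so each
  letter contributes an error of at most \<open>\<delta>\<close>.\<close>

lemma word_sum_oscillation: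
  assumes "\<And>j. j \<in> J \<Longrightarrow> f j \<in> X \<rightarrow> X" "set C \<subseteq> J" "y \<in> X" "z \<in> word_ball X f y C \<epsilon>"
    and osc: "\<And>j u v. j \<in> J \<Longrightarrow> u \<in> X \<Longrightarrow> v \<in> X \<Longrightarrow> dist u v < \<epsilon> \<Longrightarrow> \<phi> j v \<le> \<phi> j u + \<delta>"
  shows "word_sum f \<phi> z C \<le> word_sum f \<phi> y C + \<delta> * real (length C)"
proof -
  have "z \<in> X"
    using assms by (simp add: word_ball_def)
  have "word_sum f \<phi> z C
    \<le> (\<Sum>k<length C. \<phi> (C ! k) (word_map f (rev (take k C)) y) + \<delta>)"
    unfolding word_sum_def
  proof (rule sum_mono)
    fix k assume k: "k \<in> {..<length C}"
    have "set (rev (take k C)) \<subseteq> J"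
      using assms(2) set_take_subset[of k C] by auto
    then show "\<phi> (C ! k) (word_map f (rev (take k C)) z)
      \<le> \<phi> (C ! k) (word_map f (rev (take k C)) y) + \<delta>"
      using k assms(2) \<open>y \<in> X\<close> \<open>z \<in> X\<close> dist_word_map_less[OF assms(4), of k]
      by (intro osc word_map_in[OF assms(1)]) auto
  qed
  then show ?thesis
    by (simp add: word_sum_def sum.distrib mult.commute)
qed

lemma lower_sum_le_word_sum:
  assumes "C \<in> words m"
  shows "lower_sum m f \<phi> (length C) x \<le> word_sum f \<phi> x C"
proof -
  have C: "set C \<subseteq> {1..m}" "C \<noteq> []"
    using assms by (auto simp: words_def)
  \<comment> \<open>To compete in the infimum over \<open>seqs m\<close>, the word is continued by
    its own first letter, an admissible one.\<close>
  define \<omega> where "\<omega> = (\<lambda>i. if i < length C then C ! i else hd C)"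
  have "\<omega> i \<in> set C" for i
    using C by (auto simp: \<omega>_def)
  then have \<omega>: "\<omega> \<in> seqs m"
    using C(1) unfolding seqs_def by blast
  have prefix: "prefix_word \<omega> (length C) = C"
    by (auto simp: prefix_word_def \<omega>_def intro: nth_equalityI)
  \<comment> \<open>A real infimum is a lower bound only for a set bounded below. Here the set is
    finite, as there are finitely many prefixes of the given length.\<close>
  have "(\<lambda>\<omega>. prefix_word \<omega> (length C)) ` seqs m \<subseteq> {D. set D \<subseteq> {1..m} \<and> length D = length C}"
    by (auto simp: prefix_word_def seqs_def)
  then have "finite ((\<lambda>\<omega>. prefix_word \<omega> (length C)) ` seqs m)"
    by (rule finite_subset) (simp add: finite_lists_length_eq)
  then have "finite (word_sum f \<phi> x ` (\<lambda>\<omega>. prefix_word \<omega> (length C)) ` seqs m)"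
    by (rule finite_imageI)
  then have "bdd_below ((\<lambda>\<omega>. word_sum f \<phi> x (prefix_word \<omega> (length C))) ` seqs m)"
    by (simp add: image_image)
  then have "lower_sum m f \<phi> (length C) x \<le> word_sum f \<phi> x (prefix_word \<omega> (length C))"
    unfolding lower_sum_def using \<omega> by (rule cINF_lower)
  then show ?thesis
    by (simp add: prefix)
qed

section \<open>Lower exhaustive pressure against amalgamated pressure\<close>

text \<open>Recentring doubles the radius and costs at most \<open>\<delta>\<close> per letter in
  the word sum, which the increase of the exponent from \<open>l\<close> to
  \<open>l + \<delta>\<close> cancels exactly.\<close>

lemma lower_exhaustive_M_le_amalgamated_M:
  assumes f: "\<And>j. j \<in> {1..m} \<Longrightarrow> f j \<in> X \<rightarrow> X" and "Y \<subseteq> X"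
    and osc: "\<And>j u v. j \<in> {1..m} \<Longrightarrow> u \<in> X \<Longrightarrow> v \<in> X \<Longrightarrow> dist u v < \<epsilon> \<Longrightarrow> \<phi> j v \<le> \<phi> j u + \<delta>"
  shows "lower_exhaustive_M m X f \<phi> Y (l + \<delta>) N (2 * \<epsilon>) \<le> amalgamated_M m X f \<phi> Y l N \<epsilon>"
  unfolding amalgamated_M_def
proof (rule INF_greatest, clarify)
  fix \<Gamma>
  assume \<Gamma>: "countable \<Gamma>" "\<Gamma> \<subseteq> words m \<times> X" "Y \<subseteq> (\<Union>(C, y)\<in>\<Gamma>. word_ball X f y C \<epsilon>)"
    "\<forall>(C, y)\<in>\<Gamma>. N \<le> length C"
  let ?t = "\<lambda>(C, y). ennreal (exp (- l * real (length C) + word_sum f \<phi> y C))"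
  have "\<forall>z\<in>Y. \<exists>\<gamma>\<in>\<Gamma>. z \<in> word_ball X f (snd \<gamma>) (fst \<gamma>) \<epsilon>"
    using \<Gamma>(3) unfolding case_prod_beta by blast
  then obtain c where c: "\<And>z. z \<in> Y \<Longrightarrow> c z \<in> \<Gamma>"
    "\<And>z. z \<in> Y \<Longrightarrow> z \<in> word_ball X f (snd (c z)) (fst (c z)) \<epsilon>"
    by metis
  \<comment> \<open>One representative for each fibre of \<open>c\<close>. Pairs that share a centre
    but differ in the word get different representatives, so the length becomes a function of the
    new centre.\<close>
  define F where "F = inv_into Y c ` c ` Y"
  let ?n = "\<lambda>z. length (fst (c z))"
  \<comment> \<open>\<open>Y\<close> may be uncountable, but only countably many pairs are assigned,
    hence only countably many representatives are chosen.\<close>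
  have "c ` Y \<subseteq> \<Gamma>"
    using c by auto
  then have "countable F"
    unfolding F_def using \<Gamma>(1) countable_subset by blast
  have "F \<subseteq> Y"
    unfolding F_def by (auto intro: inv_into_into)
  have "inj_on c F"
    unfolding F_def by (auto simp: inj_on_def f_inv_into_f)
  have word: "fst (c z) \<in> words m" "snd (c z) \<in> X" "N \<le> ?n z" if "z \<in> Y" for z
    using c(1)[OF that] \<Gamma>(2,4) by auto
  have "Y \<subseteq> (\<Union>x\<in>F. exhaustive_ball m X f (?n x) x (2 * \<epsilon>))"
  proof
    fix z assume z: "z \<in> Y"
    \<comment> \<open>The representative of the pair assigned to \<open>z\<close>: both points lie
      in the same ball of radius \<open>\<epsilon>\<close>, so recentring at \<open>x\<close> still
      captures \<open>z\<close>.\<close>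
    define x where "x = inv_into Y c (c z)"
    have x: "x \<in> F" "x \<in> Y" "c x = c z"
      using z by (auto simp: x_def F_def inv_into_into f_inv_into_f)
    have "z \<in> word_ball X f x (fst (c x)) (2 * \<epsilon>)"
      using word_ball_recentre[OF c(2)[OF x(2)]] c(2)[OF z] x(3) by auto
    then have "z \<in> exhaustive_ball m X f (?n x) x (2 * \<epsilon>)"
      using word(1)[OF x(2)] unfolding exhaustive_ball_def words_def by blast
    then show "z \<in> (\<Union>x\<in>F. exhaustive_ball m X f (?n x) x (2 * \<epsilon>))"
      using x(1) by blast
  qed
  then have "lower_exhaustive_M m X f \<phi> Y (l + \<delta>) N (2 * \<epsilon>)
    \<le> (\<Sum>\<^sub>\<infinity>x\<in>F. ennreal (exp (lower_sum m f \<phi> (?n x) x - (l + \<delta>) * real (?n x))))"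
    unfolding lower_exhaustive_M_def
    using \<open>countable F\<close> \<open>F \<subseteq> Y\<close> \<open>Y \<subseteq> X\<close> word(3) by (intro INF_lower2[of "(F, ?n)"]) auto
  \<comment> \<open>Each new centre is charged to the pair of \<open>\<Gamma>\<close> assigned to
    it.\<close>
  also have "\<dots> \<le> infsum ?t \<Gamma>"
  proof (rule infsum_ennreal_reindex_le[OF \<open>inj_on c F\<close>])
    show "c ` F \<subseteq> \<Gamma>"
      using c \<open>F \<subseteq> Y\<close> by auto
    fix x assume "x \<in> F"
    then have x: "x \<in> Y"
      using \<open>F \<subseteq> Y\<close> by auto
    have "set (fst (c x)) \<subseteq> {1..m}"
      using word(1)[OF x] by (auto simp: words_def)
    then have "word_sum f \<phi> x (fst (c x))
      \<le> word_sum f \<phi> (snd (c x)) (fst (c x)) + \<delta> * real (?n x)"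
      using f osc by (intro word_sum_oscillation[OF _ _ word(2)[OF x] c(2)[OF x]])
    with lower_sum_le_word_sum[OF word(1)[OF x], of f \<phi> x]
    have "lower_sum m f \<phi> (?n x) x - (l + \<delta>) * real (?n x)
      \<le> - l * real (?n x) + word_sum f \<phi> (snd (c x)) (fst (c x))"
      by (simp add: algebra_simps)
    then show "ennreal (exp (lower_sum m f \<phi> (?n x) x - (l + \<delta>) * real (?n x))) \<le> ?t (c x)"
      by (simp add: case_prod_beta ennreal_leI)
  qed
  finally show "lower_exhaustive_M m X f \<phi> Y (l + \<delta>) N (2 * \<epsilon>) \<le> infsum ?t \<Gamma>" .
qed

text \<open>Uniform continuity on a compact set gives a radius for each potential; finiteness of
  \<open>J\<close> allows the minimum. The one-sided bound loses nothing, since \<open>u\<close> and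
  \<open>v\<close> may be exchanged.\<close>

lemma uniform_modulus_finite_family:
  fixes \<phi> :: "'i \<Rightarrow> 'a::metric_space \<Rightarrow> real"
  assumes "finite J" "compact X" "\<And>j. j \<in> J \<Longrightarrow> continuous_on X (\<phi> j)" "\<delta> > 0"
  shows "\<exists>r>0. \<forall>j\<in>J. \<forall>u\<in>X. \<forall>v\<in>X. dist u v < r \<longrightarrow> \<phi> j v \<le> \<phi> j u + \<delta>"
  using assms(1,3)
proof (induction J rule: finite_induct)
  case empty
  show ?case by (auto intro: zero_less_one)
next
  case (insert i J)
  then obtain r where r: "r > 0" "\<forall>j\<in>J. \<forall>u\<in>X. \<forall>v\<in>X. dist u v < r \<longrightarrow> \<phi> j v \<le> \<phi> j u + \<delta>"
    by auto
  have "uniformly_continuous_on X (\<phi> i)"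
    using insert.prems assms(2) by (intro compact_uniformly_continuous) auto
  then obtain s where "s > 0" "\<forall>u\<in>X. \<forall>v\<in>X. dist v u < s \<longrightarrow> dist (\<phi> i v) (\<phi> i u) < \<delta>"
    unfolding uniformly_continuous_on_def using \<open>\<delta> > 0\<close> by blast
  then have s: "s > 0" "\<forall>u\<in>X. \<forall>v\<in>X. dist u v < s \<longrightarrow> \<phi> i v \<le> \<phi> i u + \<delta>"
    by (auto simp: dist_real_def dist_commute abs_less_iff) (smt (verit) dist_commute)
  show ?case
    using r s by (intro exI[of _ "min r s"]) auto
qed

lemma lower_exhaustive_le_amalgamated_pressure:
  assumes "compact X" and f: "\<And>j. j \<in> {1..m} \<Longrightarrow> f j \<in> X \<rightarrow> X"
    and "\<And>j. j \<in> {1..m} \<Longrightarrow> continuous_on X (\<phi> j)" and "Y \<subseteq> X"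
  shows "lower_exhaustive_pressure m X f \<phi> Y \<le> amalgamated_pressure m X f \<phi> Y"
  unfolding amalgamated_pressure_def lower_exhaustive_pressure_def
proof (rule caratheodory_pressure_le[OF covering_sum_amalgamated covering_sum_lower_exhaustive])
  fix \<delta> \<epsilon>' :: real assume "\<delta> > 0" "\<epsilon>' > 0"
  then obtain r where r: "r > 0"
    "\<forall>j\<in>{1..m}. \<forall>u\<in>X. \<forall>v\<in>X. dist u v < r \<longrightarrow> \<phi> j v \<le> \<phi> j u + \<delta>"
    using uniform_modulus_finite_family[of "{1..m}" X \<phi> \<delta>] assms by auto
  \<comment> \<open>At most \<open>r\<close> for the oscillation bound, and at most half of
    \<open>\<epsilon>'\<close> because recentring doubles the radius.\<close>
  define \<epsilon> where "\<epsilon> = min r (\<epsilon>' / 2)"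
  have le: "lower_exhaustive_M m X f \<phi> Y (l + \<delta>) N \<epsilon>' \<le> amalgamated_M m X f \<phi> Y l N \<epsilon>" for l N
  proof -
    have "lower_exhaustive_M m X f \<phi> Y (l + \<delta>) N \<epsilon>'
      \<le> lower_exhaustive_M m X f \<phi> Y (l + \<delta>) N (2 * \<epsilon>)"
      using covering_sum_lower_exhaustive[of m X f \<phi> Y]
      by (auto simp: covering_sum_def antimono_def \<epsilon>_def)
    also have "\<dots> \<le> amalgamated_M m X f \<phi> Y l N \<epsilon>"
      using r(2) by (intro lower_exhaustive_M_le_amalgamated_M f \<open>Y \<subseteq> X\<close>) (auto simp: \<epsilon>_def)
    finally show ?thesis .
  qed
  have "\<epsilon> > 0"
    using r \<open>\<epsilon>' > 0\<close> by (simp add: \<epsilon>_def)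
  with le show "\<exists>\<epsilon>>0. \<exists>d\<le>\<delta>. \<forall>l. (\<forall>N. amalgamated_M m X f \<phi> Y l N \<epsilon> = 0) \<longrightarrow>
      (\<forall>N. lower_exhaustive_M m X f \<phi> Y (l + d) N \<epsilon>' = 0)"
    by (metis le_zero_eq order_refl)
qed

theorem theorem3p14:
  fixes X Y :: "'a::metric_space set"
    and m :: nat
    and f :: "nat \<Rightarrow> 'a \<Rightarrow> 'a"
    and \<phi> :: "nat \<Rightarrow> 'a \<Rightarrow> real"
    and \<omega> :: "nat \<Rightarrow> nat"
  assumes "compact X"
    and "\<And>j. j \<in> {1..m} \<Longrightarrow> f j \<in> X \<rightarrow> X"
    and "\<And>j. j \<in> {1..m} \<Longrightarrow> continuous_on X (f j)"
    and "\<And>j. j \<in> {1..m} \<Longrightarrow> continuous_on X (\<phi> j)"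
    and "Y \<subseteq> X"
    and "\<omega> \<in> seqs m"
  shows "(lower_exhaustive_pressure m X f \<phi> Y \<le> amalgamated_pressure m X f \<phi> Y \<and>
          amalgamated_pressure m X f \<phi> Y \<le> trajectory_pressure X f \<phi> Y \<omega>) \<and>
         (\<forall>j\<in>{1..m}.
            lower_exhaustive_pressure m X f \<phi> Y \<le> amalgamated_pressure m X f \<phi> Y \<and>
            amalgamated_pressure m X f \<phi> Y \<le> topological_pressure X (f j) (\<phi> j) Y)"
  \<comment> \<open>The sequence is left open in the second fact, which serves both
    \<open>\<omega>\<close> and the constant sequence at \<open>j\<close>; along the latter the
    trajectory pressure is the pressure of the single map.\<close>
  using lower_exhaustive_le_amalgamated_pressure[of X m f \<phi> Y] assms
    amalgamated_le_trajectory_pressure[of Y X _ m f \<phi>]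
  by (auto simp: seqs_def simp flip: trajectory_pressure_const)

end
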